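(* Let $d$ and $m$ be positive integers, and let $X = \{x_1, \dots, x_m\} \subset \mathbb{R}^{d-1}$ be a set of $m$ points. Let $A_1, \dots, A_m \subset S^d$ be closed sets such that $A_i \cap (-A_i) = \emptyset$ for all $i \in [m]$ and $\bigcup_i A_i \cup \bigcup_i (-A_i) = S^d$. Then there are disjoint subsets $S, T \subset [m]$ such that \[\operatorname{conv}\{x_i \mid i \in S\} \cap \operatorname{conv}\{x_i \mid i \in T\} \neq \emptyset \quad \text{and} \quad \bigcap_{i \in S} A_i \cap \bigcap_{i \in T} (-A_i) \neq \emptyset.\]
   Context: $[m]=\{1,\dots,m\}$. For $A\subset S^d$, $-A=\{-x \mid x\in A\}$. $\operatorname{conv}$ denotes convex hull. *)

theory Defs
  imports "HOL-Analysis.Analysis" "HOL-Library.Function_Algebras"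
begin

text \<open>
  The spaces \<^term>\<open>Euclidean_space n\<close> (including \<open>n = 0\<close>, a single point) and
  \<^term>\<open>nsphere n\<close> (the unit sphere in \<^term>\<open>Euclidean_space (Suc n)\<close>) live on the type
  \<^typ>\<open>nat \<Rightarrow> real\<close>.  Addition and negation of functions are pointwise by
  \<^theory>\<open>HOL-Library.Function_Algebras\<close>; with pointwise scaling, \<^const>\<open>hull\<close> and
  \<^const>\<open>convex\<close> apply to subsets of these spaces.
\<close>

instantiation "fun" :: (type, real_vector) real_vector
begin

definition scaleR_fun :: "real \<Rightarrow> ('a \<Rightarrow> 'b) \<Rightarrow> 'a \<Rightarrow> 'b"
  where "scaleR_fun r f = (\<lambda>i. r *\<^sub>R f i)"

instance
  by standard (simp_all add: scaleR_fun_def fun_eq_iff scaleR_add_right scaleR_add_left)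

end

end

theory Submission
  imports Defs "HOL-Homology.Invariance_of_Domain"
begin

text \<open>
  For \<open>\<epsilon> > 0\<close> put \<open>g\<^sub>i(z) = max 0 (\<epsilon> - dist(z, A\<^sub>i))\<close> and \<open>f\<^sub>i(z) = g\<^sub>i(z) - g\<^sub>i(-z)\<close>. By the Borsuk-Ulam theorem
  the odd map \<open>z \<mapsto> (\<Sum>\<^sub>i f\<^sub>i(z), \<Sum>\<^sub>i f\<^sub>i(z) x\<^sub>i)\<close> from the \<open>d\<close>-sphere to \<open>d\<close>-space has a zero. There the
  signs of the \<open>f\<^sub>i\<close>, which do not all vanish, give an affine dependence of the \<open>x\<^sub>i\<close>, hence disjoint
  \<open>S\<close> and \<open>T\<close> with intersecting convex hulls such that \<open>z\<close> is \<open>\<epsilon>\<close>-close to \<open>A\<^sub>i\<close> for \<open>i \<in> S\<close> and to \<open>-A\<^sub>i\<close> for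
  \<open>i \<in> T\<close>. Letting \<open>\<epsilon>\<close> tend to \<open>0\<close>, compactness gives the result.

  The Borsuk-Ulam theorem follows from the fact that an odd self-map of a sphere has odd degree,
  proved by induction on the dimension: an odd map can be deformed through odd maps into one that
  preserves the equator, which leaves the parity of the degree unchanged on restriction. For the
  deformation, approximate the map by an odd Lipschitz map; by a counting argument the image of the
  equator misses some pair of opposite directions, away from which it can be pushed.
\<close>

section \<open>Spheres\<close>

text \<open>Radial projection using the coordinates up to \<open>n\<close>. If these all vanish,
  division by zero yields the zero function, which is off the sphere; hence the nonvanishing
  hypotheses wherever it is used.\<close>

definition sphere_projection :: "nat \<Rightarrow> (nat \<Rightarrow> real) \<Rightarrow> nat \<Rightarrow> real"
  where "sphere_projection n v = (\<lambda>i. if i \<le> n then v i / sqrt (\<Sum>j\<le>n. (v j)\<^sup>2) else 0)"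

lemma topspace_nsphere:
  "topspace (nsphere n) = {x. (\<Sum>i\<le>n. (x i)\<^sup>2) = 1 \<and> (\<forall>i>n. x i = 0)}"
  by (simp add: nsphere)

text \<open>The type \<open>nat \<Rightarrow> real\<close> carries the product topology, so facts
  about \<open>continuous_on\<close>, \<open>compact\<close> and \<open>closed\<close> can be
  exchanged for facts about the abstract topology \<open>nsphere n\<close>.\<close>

lemma nsphere_eq_top_of_set: "nsphere n = top_of_set (topspace (nsphere n))"
  by (simp add: nsphere euclidean_product_topology)

lemma uminus_in_nsphere [simp]: "- x \<in> topspace (nsphere n) \<longleftrightarrow> x \<in> topspace (nsphere n)"
  by (simp add: topspace_nsphere)

lemma abs_coordinate_nsphere_le_1:
  assumes "x \<in> topspace (nsphere n)"
  shows "\<bar>x i\<bar> \<le> 1"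
proof (cases "i \<le> n")
  case True
  then have "(x i)\<^sup>2 \<le> (\<Sum>i\<le>n. (x i)\<^sup>2)"
    by (intro member_le_sum) auto
  also have "\<dots> = 1"
    using assms by (simp add: topspace_nsphere)
  finally show ?thesis
    by (simp add: abs_square_le_1)
qed (use assms in \<open>auto simp: topspace_nsphere\<close>)

lemma topspace_nsphere_mono: "m \<le> n \<Longrightarrow> topspace (nsphere m) \<subseteq> topspace (nsphere n)"
proof
  fix x assume "m \<le> n" "x \<in> topspace (nsphere m)"
  then have x: "(\<Sum>i\<le>m. (x i)\<^sup>2) = 1" "\<And>i. i > m \<Longrightarrow> x i = 0"
    by (auto simp: topspace_nsphere)
  have "(\<Sum>i\<le>n. (x i)\<^sup>2) = (\<Sum>i\<le>m. (x i)\<^sup>2)"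
    using \<open>m \<le> n\<close> x by (intro sum.mono_neutral_right) auto
  then show "x \<in> topspace (nsphere n)"
    using x \<open>m \<le> n\<close> by (auto simp: topspace_nsphere)
qed

lemma continuous_on_coordinate: "continuous_on S (\<lambda>x. (x :: nat \<Rightarrow> real) i)"
  by (rule continuous_on_subset [OF continuous_on_product_coordinates]) simp

lemma continuous_on_uminus_fun: "continuous_on S (uminus :: (nat \<Rightarrow> real) \<Rightarrow> nat \<Rightarrow> real)"
  unfolding fun_Compl_def
  by (intro continuous_on_coordinatewise_then_product continuous_intros continuous_on_coordinate)

text \<open>The sphere is a closed subset of a product of copies of \<open>{-1..1}\<close>, which is
  compact by Tychonoff.\<close>

lemma compact_nsphere: "compact (topspace (nsphere n))"
proof -
  have "compactin (powertop_real UNIV) (PiE (UNIV :: nat set) (\<lambda>i. {-1..1::real}))"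
    by (subst compactin_PiE) auto
  then have "compact (PiE (UNIV :: nat set) (\<lambda>i. {-1..1::real}))"
    by (simp add: euclidean_product_topology)
  moreover have "closed (topspace (nsphere n))"
  proof -
    have "topspace (nsphere n) = {x. (\<Sum>i\<le>n. (x i)\<^sup>2) = 1} \<inter> (\<Inter>i\<in>{n<..}. {x. x i = 0})"
      by (auto simp: topspace_nsphere)
    then show ?thesis
      by (auto intro!: closed_Collect_eq closed_Int closed_INT continuous_intros continuous_on_coordinate)
  qed
  moreover have "topspace (nsphere n) \<subseteq> PiE (UNIV :: nat set) (\<lambda>i. {-1..1::real})"
    using abs_coordinate_nsphere_le_1 by (force simp: abs_le_iff)
  ultimately show ?thesis
    by (metis compact_Int_closed inf.absorb2)
qed

lemma sphere_projection_in_nsphere: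
  assumes "k \<le> n" "v k \<noteq> 0"
  shows "sphere_projection n v \<in> topspace (nsphere n)"
proof -
  have "(\<Sum>j\<le>n. (v j)\<^sup>2) > 0"
    using assms by (intro sum_pos2 [of _ k]) auto
  then show ?thesis
    by (auto simp: topspace_nsphere sphere_projection_def power_divide simp flip: sum_divide_distrib)
qed

lemma sphere_projection_id:
  "x \<in> topspace (nsphere n) \<Longrightarrow> sphere_projection n x = x"
  by (auto simp: sphere_projection_def topspace_nsphere fun_eq_iff)

lemma sphere_projection_uminus: "sphere_projection n (- v) = - sphere_projection n v"
  by (auto simp: sphere_projection_def)

lemma continuous_on_sphere_projection:
  assumes "\<And>k. k \<le> n \<Longrightarrow> continuous_on X (\<lambda>x. f x k)"
    and "\<And>x. x \<in> X \<Longrightarrow> \<exists>k\<le>n. f x k \<noteq> 0"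
  shows "continuous_on X (\<lambda>x. sphere_projection n (f x))"
proof -
  have "(\<Sum>j\<le>n. (f x j)\<^sup>2) \<noteq> 0" if "x \<in> X" for x
    using assms(2) [OF that] by (auto simp: sum_nonneg_eq_0_iff)
  then have "continuous_on X (\<lambda>x. sphere_projection n (f x) i)" for i
    using assms(1) by (cases "i \<le> n") (auto simp: sphere_projection_def intro!: continuous_intros)
  then show ?thesis
    by (rule continuous_on_coordinatewise_then_product)
qed

lemma continuous_map_into_nsphere_iff:
  "continuous_map (top_of_set X) (nsphere n) f \<longleftrightarrow>
    continuous_on X f \<and> f \<in> X \<rightarrow> topspace (nsphere n)"
  by (subst nsphere_eq_top_of_set) (simp add: continuous_map_in_subtopology)

lemma continuous_map_nsphere_iff:
  "continuous_map (nsphere m) (nsphere n) f \<longleftrightarrow>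
    continuous_on (topspace (nsphere m)) f \<and> f \<in> topspace (nsphere m) \<rightarrow> topspace (nsphere n)"
  by (subst nsphere_eq_top_of_set) (rule continuous_map_into_nsphere_iff)

text \<open>A homotopy only has to avoid the origin: radial projection turns it into a homotopy of
  self-maps of the sphere. This allows the linear deformations used later.\<close>

lemma Brouwer_degree2_sphere_projection_homotopic:
  assumes cont: "\<And>k. k \<le> n \<Longrightarrow> continuous_on ({0..1} \<times> topspace (nsphere n)) (\<lambda>p. H (fst p) (snd p) k)"
    and nz: "\<And>t x. t \<in> {0..1} \<Longrightarrow> x \<in> topspace (nsphere n) \<Longrightarrow> \<exists>k\<le>n. H t x k \<noteq> (0::real)"
  shows "Brouwer_degree2 n (\<lambda>x. sphere_projection n (H 0 x)) =
         Brouwer_degree2 n (\<lambda>x. sphere_projection n (H (1::real) x))"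
proof (rule Brouwer_degree2_homotopic)
  have prod_eq: "prod_topology (top_of_set {0..1}) (nsphere n)
      = top_of_set ({0..1::real} \<times> topspace (nsphere n))"
    by (subst nsphere_eq_top_of_set) (simp only: prod_topology_subtopology_eu)
  have "continuous_on ({0..1} \<times> topspace (nsphere n)) (\<lambda>p. sphere_projection n (H (fst p) (snd p)))"
    using cont by (rule continuous_on_sphere_projection) (use nz in auto)
  moreover have "(\<lambda>p. sphere_projection n (H (fst p) (snd p)))
      \<in> {0..1} \<times> topspace (nsphere n) \<rightarrow> topspace (nsphere n)"
  proof (clarify, unfold fst_conv snd_conv)
    fix t :: real and x assume "t \<in> {0..1}" "x \<in> topspace (nsphere n)"
    then show "sphere_projection n (H t x) \<in> topspace (nsphere n)"
      using nz sphere_projection_in_nsphere by blast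
  qed
  ultimately have "continuous_map (prod_topology (top_of_set {0..1}) (nsphere n)) (nsphere n)
      (\<lambda>p. sphere_projection n (H (fst p) (snd p)))"
    unfolding prod_eq continuous_map_into_nsphere_iff by blast
  then show "homotopic_with (\<lambda>x. True) (nsphere n) (nsphere n)
      (\<lambda>x. sphere_projection n (H 0 x)) (\<lambda>x. sphere_projection n (H 1 x))"
    unfolding homotopic_with_def
    by (intro exI [of _ "\<lambda>p. sphere_projection n (H (fst p) (snd p))"]) simp
qed

section \<open>Lipschitz maps from a sphere miss a direction\<close>

text \<open>Some square is at least the average \<open>1 / (p + 1)\<close>, and
  \<open>\<bar>x k\<bar>\<close> dominates its square because it is at most 1.\<close>

lemma nsphere_large_coordinate:
  assumes "x \<in> topspace (nsphere p)"
  obtains k where "k \<le> p" "\<bar>x k\<bar> \<ge> 1 / (p + 1)"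
proof -
  have "\<exists>k\<le>p. \<bar>x k\<bar> \<ge> 1 / (p + 1)"
  proof (rule ccontr)
    assume "\<not> ?thesis"
    then have less: "\<bar>x k\<bar> < 1 / (p + 1)" if "k \<le> p" for k
      using that by force
    have "(x k)\<^sup>2 < 1 / (p + 1)" if "k \<le> p" for k
    proof -
      have "(x k)\<^sup>2 = \<bar>x k\<bar> * \<bar>x k\<bar>"
        by (simp add: power2_eq_square)
      also have "\<dots> \<le> \<bar>x k\<bar> * 1"
        using assms by (intro mult_left_mono abs_coordinate_nsphere_le_1) auto
      finally show ?thesis
        using less [OF that] by simp
    qed
    then have "(\<Sum>k\<le>p. (x k)\<^sup>2) < (\<Sum>k\<le>p. 1 / (p + 1))"
      by (intro sum_strict_mono) auto
    then show False
      using assms by (simp add: topspace_nsphere)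
  qed
  then show thesis
    using that by blast
qed

text \<open>
  On the part of the sphere where \<open>\<bar>x k\<bar>\<close> is bounded below and the sign of \<open>x k\<close> is fixed, \<open>x k\<close> is a
  Lipschitz function of the other \<open>p\<close> coordinates, so about \<open>N\<^sup>p\<close> boxes suffice to cover the sphere.
\<close>

lemma nsphere_pigeonhole:
  fixes x :: "'a \<Rightarrow> nat \<Rightarrow> real"
  assumes "finite C" and x: "\<And>a. a \<in> C \<Longrightarrow> x a \<in> topspace (nsphere p)" and "N \<ge> 1"
    and card: "card C > 2 * (p + 1) * (2 * N + 1) ^ p"
  obtains a b where "a \<in> C" "b \<in> C" "a \<noteq> b" "\<forall>j\<le>p. \<bar>x a j - x b j\<bar> \<le> (real p + 1)\<^sup>2 / N"
proof -
  have "\<exists>k. k \<le> p \<and> \<bar>x a k\<bar> \<ge> 1 / (p + 1)" if "a \<in> C" for a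
    using nsphere_large_coordinate [OF x [OF that]] by blast
  then obtain k where k: "\<And>a. a \<in> C \<Longrightarrow> k a \<le> p" "\<And>a. a \<in> C \<Longrightarrow> \<bar>x a (k a)\<bar> \<ge> 1 / (p + 1)"
    by metis
  \<comment> \<open>The large coordinate enters only through its index and sign. Thus only
    \<open>p\<close> coordinates are discretised, which gives the exponent \<open>p\<close> in the
    count.\<close>
  define box where "box a = (k a, x a (k a) > 0, restrict (\<lambda>j. \<lfloor>N * x a j\<rfloor>) ({..p} - {k a}))" for a
  define B where "B = (SIGMA i:{..p}. (UNIV :: bool set) \<times> ({..p} - {i} \<rightarrow>\<^sub>E {- int N..int N}))"
  have "box ` C \<subseteq> B"
  proof
    fix q assume "q \<in> box ` C"
    then obtain a where a: "a \<in> C" "q = box a"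
      by blast
    have "\<lfloor>N * x a j\<rfloor> \<in> {- int N..int N}" for j
    proof -
      have "\<bar>N * x a j\<bar> \<le> N"
        using abs_coordinate_nsphere_le_1 [OF x [OF a(1)]] by (simp add: abs_mult mult_left_le)
      then show ?thesis
        unfolding atLeastAtMost_iff by linarith
    qed
    then show "q \<in> B"
      using k(1) [OF a(1)] by (simp add: a(2) box_def B_def)
  qed
  moreover have "card B = 2 * (p + 1) * (2 * N + 1) ^ p"
  proof -
    have "card ((UNIV :: bool set) \<times> ({..p} - {i} \<rightarrow>\<^sub>E {- int N..int N})) = 2 * (2 * N + 1) ^ p"
      if "i \<le> p" for i
      using that by (simp add: card_cartesian_product card_PiE nat_add_distrib nat_mult_distrib)
    then show ?thesis
      unfolding B_def by (subst card_SigmaI) (auto intro!: finite_PiE)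
  qed
  moreover have "finite B"
    by (auto simp: B_def intro!: finite_SigmaI finite_PiE)
  ultimately have "card (box ` C) < card C"
    using card card_mono by (metis le_less_trans)
  then have "\<not> inj_on box C"
    using pigeonhole by blast
  then obtain a b where ab: "a \<in> C" "b \<in> C" "a \<noteq> b" "box a = box b"
    by (auto simp: inj_on_def)
  have kb: "k b = k a" and sgn: "x a (k a) > 0 \<longleftrightarrow> x b (k a) > 0"
    using ab(4) by (auto simp: box_def)
  have box_eq: "restrict (\<lambda>j. \<lfloor>N * x a j\<rfloor>) ({..p} - {k a}) = restrict (\<lambda>j. \<lfloor>N * x b j\<rfloor>) ({..p} - {k a})"
    using ab(4) kb by (auto simp: box_def)
  have fl: "\<lfloor>N * x a j\<rfloor> = \<lfloor>N * x b j\<rfloor>" if "j \<le> p" "j \<noteq> k a" for j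
    using fun_cong [OF box_eq, of j] that by simp
  have near: "\<bar>x a j - x b j\<bar> \<le> 1 / N" if "j \<le> p" "j \<noteq> k a" for j
  proof -
    have "\<bar>N * x a j - N * x b j\<bar> \<le> 1"
      using fl [OF that] by linarith
    then have "N * \<bar>x a j - x b j\<bar> \<le> 1"
      by (simp add: abs_mult flip: right_diff_distrib)
    then show ?thesis
      using \<open>N \<ge> 1\<close> by (simp add: field_simps)
  qed
  have near_sq: "\<bar>(x a j)\<^sup>2 - (x b j)\<^sup>2\<bar> \<le> 2 / N" if "j \<le> p" "j \<noteq> k a" for j
  proof -
    have "\<bar>(x a j)\<^sup>2 - (x b j)\<^sup>2\<bar> = \<bar>x a j + x b j\<bar> * \<bar>x a j - x b j\<bar>"
      by (simp add: power2_eq_square square_diff_square_factored abs_mult)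
    also have "\<dots> \<le> 2 * (1 / N)"
      using near [OF that] abs_coordinate_nsphere_le_1 [OF x, of a j] abs_coordinate_nsphere_le_1 [OF x, of b j] ab
      by (intro mult_mono) auto
    finally show ?thesis by simp
  qed
  have kp: "k a \<le> p"
    using k ab by blast
  \<comment> \<open>Both points have squared norm 1, so the change in the square of the large
    coordinate is balanced by the changes in the others.\<close>
  have "(x a (k a))\<^sup>2 - (x b (k a))\<^sup>2 = - (\<Sum>j\<in>{..p} - {k a}. (x a j)\<^sup>2 - (x b j)\<^sup>2)"
  proof -
    have "(\<Sum>j\<le>p. (x a j)\<^sup>2 - (x b j)\<^sup>2) = 0"
      using x [OF ab(1)] x [OF ab(2)] by (simp add: sum_subtractf topspace_nsphere)
    then show ?thesis
      using kp by (simp add: sum.remove [of "{..p}" "k a"])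
  qed
  then have "\<bar>(x a (k a))\<^sup>2 - (x b (k a))\<^sup>2\<bar> = \<bar>\<Sum>j\<in>{..p} - {k a}. (x a j)\<^sup>2 - (x b j)\<^sup>2\<bar>"
    by (simp only: abs_minus_cancel)
  also have "\<dots> \<le> (\<Sum>j\<in>{..p} - {k a}. \<bar>(x a j)\<^sup>2 - (x b j)\<^sup>2\<bar>)"
    by (rule sum_abs)
  also have "\<dots> \<le> (\<Sum>j\<in>{..p} - {k a}. 2 / N)"
    by (intro sum_mono near_sq) auto
  also have "\<dots> = p * 2 / N"
    using kp by simp
  finally have sq: "\<bar>(x a (k a))\<^sup>2 - (x b (k a))\<^sup>2\<bar> \<le> p * 2 / N" .
  \<comment> \<open>The two large coordinates have the same sign, so their absolute values add up.
    Dividing the difference of squares by this sum bounds the difference itself.\<close>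
  have "2 / (p + 1) \<le> \<bar>x a (k a) + x b (k a)\<bar>"
    using k(2) [OF ab(1)] k(2) [OF ab(2)] sgn unfolding kb by (auto simp: abs_if split: if_splits)
  then have "2 / (p + 1) * \<bar>x a (k a) - x b (k a)\<bar> \<le> \<bar>x a (k a) + x b (k a)\<bar> * \<bar>x a (k a) - x b (k a)\<bar>"
    by (intro mult_right_mono) auto
  also have "\<dots> \<le> p * 2 / N"
    using sq by (simp add: power2_eq_square square_diff_square_factored abs_mult)
  finally have "\<bar>x a (k a) - x b (k a)\<bar> \<le> p * (p + 1) / N"
    using \<open>N \<ge> 1\<close> by (simp add: field_simps)
  also have "\<dots> \<le> (real p + 1)\<^sup>2 / N"
    by (intro divide_right_mono) (auto simp: power2_eq_square algebra_simps)
  finally have "\<bar>x a (k a) - x b (k a)\<bar> \<le> (real p + 1)\<^sup>2 / N" .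
  moreover have "1 / N \<le> (real p + 1)\<^sup>2 / real N"
    by (intro divide_right_mono) auto
  ultimately have "\<bar>x a j - x b j\<bar> \<le> (real p + 1)\<^sup>2 / N" if "j \<le> p" for j
    using near [OF that] by (cases "j = k a") auto
  then show thesis
    using that ab by blast
qed

text \<open>
  If every grid point \<open>c \<in> {0, 1/M, \<dots>, 1}\<^sup>p\<^sup>+\<^sup>1\<close> were of the form \<open>g\<^sub>i(x)/g\<^sub>p\<^sub>+\<^sub>1(x)\<close>, the corresponding
  \<open>(M + 1)\<^sup>p\<^sup>+\<^sup>1\<close> points \<open>x\<close> of the \<open>p\<close>-sphere would have mutual distance at least a constant times
  \<open>1/M\<close>, too many for large \<open>M\<close>.
\<close>

lemma Lipschitz_nsphere_avoids_direction:
  fixes g :: "(nat \<Rightarrow> real) \<Rightarrow> nat \<Rightarrow> real"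
  assumes lip: "\<And>i x y. \<lbrakk>i \<le> Suc p; x \<in> topspace (nsphere p); y \<in> topspace (nsphere p)\<rbrakk>
      \<Longrightarrow> \<bar>g x i - g y i\<bar> \<le> L * (\<Sum>j\<le>p. \<bar>x j - y j\<bar>)"
    and "\<delta> > 0" and nz: "\<And>x. x \<in> topspace (nsphere p) \<Longrightarrow> \<exists>i\<le>Suc p. \<bar>g x i\<bar> \<ge> \<delta>"
  obtains c where "\<And>x. x \<in> topspace (nsphere p) \<Longrightarrow> \<exists>i\<le>p. g x i \<noteq> c i * g x (Suc p)"
proof (rule ccontr)
  assume "\<not> thesis"
  then have ex: "\<exists>x\<in>topspace (nsphere p). \<forall>i\<le>p. g x i = c i * g x (Suc p)" for c
    using that by blast
  \<comment> \<open>\<open>K\<close> is chosen to contradict the last estimate,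
    \<open>\<delta> * K \<le> 2 * \<bar>L\<bar> * (real p + 1) ^ 3\<close>.\<close>
  define K where "K = nat \<lceil>2 * \<bar>L\<bar> * (real p + 1) ^ 3 / \<delta>\<rceil> + 1"
  have K: "2 * \<bar>L\<bar> * (real p + 1) ^ 3 / \<delta> < K" and "K \<ge> 1"
    unfolding K_def by linarith+
  \<comment> \<open>With \<open>N = K * M\<close>, the factor \<open>2 * N + 1\<close> is at most
    \<open>(2 * K + 1) * (M + 1)\<close>. This \<open>M\<close> then makes the pigeonhole bound at
    most \<open>M * (M + 1) ^ p\<close>, fewer than the grid points.\<close>
  define M where "M = 2 * (p + 1) * (2 * K + 1) ^ p"
  define N where "N = K * M"
  have "M > 0"
    by (simp add: M_def)
  then have "M \<ge> 1"
    by simp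
  with \<open>K \<ge> 1\<close> have "N \<ge> 1"
    by (simp add: N_def)
  define C where "C = ({..p} \<rightarrow>\<^sub>E {..M})"
  have "finite C"
    by (auto simp: C_def intro!: finite_PiE)
  obtain x where x: "\<And>a. x a \<in> topspace (nsphere p)"
    and gx: "\<And>a i. i \<le> p \<Longrightarrow> g (x a) i = real (a i) / M * g (x a) (Suc p)"
    using ex [of "\<lambda>i. real (_ i) / M"] by metis
  have "2 * (p + 1) * (2 * N + 1) ^ p \<le> 2 * (p + 1) * ((2 * K + 1) * (M + 1)) ^ p"
    by (intro mult_left_mono power_mono) (auto simp: N_def algebra_simps)
  also have "\<dots> = M * (M + 1) ^ p"
    by (simp only: M_def power_mult_distrib mult.assoc)
  also have "\<dots> < (M + 1) ^ (p + 1)"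
    by simp
  also have "\<dots> = card C"
    by (simp add: C_def card_PiE)
  finally have card: "2 * (p + 1) * (2 * N + 1) ^ p < card C" .
  obtain a b where ab: "a \<in> C" "b \<in> C" "a \<noteq> b"
    and near: "\<forall>j\<le>p. \<bar>x a j - x b j\<bar> \<le> (real p + 1)\<^sup>2 / N"
    by (rule nsphere_pigeonhole [of C x, OF \<open>finite C\<close> x \<open>N \<ge> 1\<close> card]) blast
  define \<eta> where "\<eta> = (real p + 1) ^ 3 / real N"
  have "(\<Sum>j\<le>p. \<bar>x a j - x b j\<bar>) \<le> (\<Sum>j\<le>p. (real p + 1)\<^sup>2 / N)"
    using near by (intro sum_mono) auto
  also have "\<dots> = \<eta>"
    by (simp add: \<eta>_def power3_eq_cube power2_eq_square algebra_simps)
  finally have "L * (\<Sum>j\<le>p. \<bar>x a j - x b j\<bar>) \<le> \<bar>L\<bar> * \<eta>"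
    by (intro mult_mono) (auto simp: sum_nonneg)
  then have g_near: "\<bar>g (x a) i - g (x b) i\<bar> \<le> \<bar>L\<bar> * \<eta>" if "i \<le> Suc p" for i
    using lip [OF that x x, of a b] by linarith
  have unit: "real (a i) / M \<in> {0..1}" if "a \<in> C" "i \<le> p" for a i
    using that \<open>M \<ge> 1\<close> by (auto simp: C_def PiE_iff)
  \<comment> \<open>The other components are multiples of the last one with factors in
    \<open>{0..1}\<close>, so the last one has the largest absolute value.\<close>
  have last: "\<delta> \<le> \<bar>g (x a) (Suc p)\<bar>"
  proof -
    obtain i where i: "i \<le> Suc p" "\<delta> \<le> \<bar>g (x a) i\<bar>"
      using nz [OF x] by blast
    show ?thesis
    proof (cases "i = Suc p")
      case False
      with i have "i \<le> p" by simp
      then have "\<bar>g (x a) i\<bar> \<le> 1 * \<bar>g (x a) (Suc p)\<bar>"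
        using unit [OF ab(1)] unfolding gx [OF \<open>i \<le> p\<close>] abs_mult by (intro mult_right_mono) auto
      with i show ?thesis by simp
    qed (use i in auto)
  qed
  obtain i where i: "i \<le> p" "a i \<noteq> b i"
    using ab by (metis C_def PiE_ext atMost_iff)
  define r s where "r = real (a i) / M" and "s = real (b i) / M"
  have "1 / M \<le> \<bar>r - s\<bar>"
  proof -
    have "1 \<le> \<bar>real (a i) - real (b i)\<bar>"
      using i(2) by linarith
    then have "1 / M \<le> \<bar>real (a i) - real (b i)\<bar> / M"
      by (intro divide_right_mono) auto
    then show ?thesis
      by (simp add: r_def s_def flip: diff_divide_distrib)
  qed
  then have "1 / M * \<delta> \<le> \<bar>r - s\<bar> * \<bar>g (x a) (Suc p)\<bar>"
    using last \<open>\<delta> > 0\<close> by (intro mult_mono) auto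
  \<comment> \<open>Substitute \<open>g (x a) i = r * g (x a) (Suc p)\<close> and
    \<open>g (x b) i = s * g (x b) (Suc p)\<close>; only differences controlled by the Lipschitz
    bound remain.\<close>
  also have "\<dots> = \<bar>(g (x a) i - g (x b) i) - s * (g (x a) (Suc p) - g (x b) (Suc p))\<bar>"
    using gx [OF i(1)] by (simp add: r_def s_def algebra_simps flip: abs_mult)
  also have "\<dots> \<le> \<bar>g (x a) i - g (x b) i\<bar> + \<bar>s\<bar> * \<bar>g (x a) (Suc p) - g (x b) (Suc p)\<bar>"
    by (metis abs_mult abs_triangle_ineq4)
  also have "\<dots> \<le> \<bar>L\<bar> * \<eta> + 1 * (\<bar>L\<bar> * \<eta>)"
    using unit [OF ab(2) i(1)] i(1) by (intro add_mono mult_mono g_near) (auto simp: s_def)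
  also have "\<dots> = 2 * \<bar>L\<bar> * (real p + 1) ^ 3 / (K * M)"
    by (simp add: \<eta>_def N_def)
  finally have "\<delta> * K \<le> 2 * \<bar>L\<bar> * (real p + 1) ^ 3"
    using \<open>M \<ge> 1\<close> \<open>K \<ge> 1\<close> by (simp add: field_simps)
  with K \<open>\<delta> > 0\<close> show False
    by (simp add: field_simps)
qed

section \<open>Lipschitz approximation of odd maps\<close>

text \<open>The sum of coordinate differences replaces \<open>dist\<close>, which on this function
  type weights and truncates the coordinates.\<close>

definition Lipschitz_nsphere :: "nat \<Rightarrow> real \<Rightarrow> ((nat \<Rightarrow> real) \<Rightarrow> real) \<Rightarrow> bool"
  where "Lipschitz_nsphere n L g \<longleftrightarrow> (\<forall>x\<in>topspace (nsphere n). \<forall>y\<in>topspace (nsphere n).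
    \<bar>g x - g y\<bar> \<le> L * (\<Sum>j\<le>n. \<bar>x j - y j\<bar>))"

lemma Lipschitz_nsphereD:
  "\<lbrakk>Lipschitz_nsphere n L g; x \<in> topspace (nsphere n); y \<in> topspace (nsphere n)\<rbrakk>
    \<Longrightarrow> \<bar>g x - g y\<bar> \<le> L * (\<Sum>j\<le>n. \<bar>x j - y j\<bar>)"
  by (simp add: Lipschitz_nsphere_def)

lemma Lipschitz_nsphere_mono:
  assumes "Lipschitz_nsphere n L g" "L \<le> M"
  shows "Lipschitz_nsphere n M g"
  unfolding Lipschitz_nsphere_def
proof (intro ballI)
  fix x y assume "x \<in> topspace (nsphere n)" "y \<in> topspace (nsphere n)"
  then have "\<bar>g x - g y\<bar> \<le> L * (\<Sum>j\<le>n. \<bar>x j - y j\<bar>)"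
    by (rule Lipschitz_nsphereD [OF assms(1)])
  also have "\<dots> \<le> M * (\<Sum>j\<le>n. \<bar>x j - y j\<bar>)"
    using assms(2) by (intro mult_right_mono) (auto simp: sum_nonneg)
  finally show "\<bar>g x - g y\<bar> \<le> M * (\<Sum>j\<le>n. \<bar>x j - y j\<bar>)" .
qed

lemma Lipschitz_nsphere_add:
  assumes "Lipschitz_nsphere n L g" "Lipschitz_nsphere n M h"
  shows "Lipschitz_nsphere n (L + M) (\<lambda>x. g x + h x)"
  unfolding Lipschitz_nsphere_def distrib_right
proof (intro ballI)
  fix x y assume xy: "x \<in> topspace (nsphere n)" "y \<in> topspace (nsphere n)"
  show "\<bar>g x + h x - (g y + h y)\<bar> \<le> L * (\<Sum>j\<le>n. \<bar>x j - y j\<bar>) + M * (\<Sum>j\<le>n. \<bar>x j - y j\<bar>)"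
    using Lipschitz_nsphereD [OF assms(1) xy] Lipschitz_nsphereD [OF assms(2) xy] by linarith
qed

lemma Lipschitz_nsphere_mult:
  assumes "Lipschitz_nsphere n L g" "Lipschitz_nsphere n M h"
    and B: "\<And>x. x \<in> topspace (nsphere n) \<Longrightarrow> \<bar>g x\<bar> \<le> B" "\<And>x. x \<in> topspace (nsphere n) \<Longrightarrow> \<bar>h x\<bar> \<le> C"
  shows "Lipschitz_nsphere n (B * M + C * L) (\<lambda>x. g x * h x)"
  unfolding Lipschitz_nsphere_def
proof (intro ballI)
  fix x y assume xy: "x \<in> topspace (nsphere n)" "y \<in> topspace (nsphere n)"
  define D where "D = (\<Sum>j\<le>n. \<bar>x j - y j\<bar>)"
  have "B \<ge> 0" "C \<ge> 0"
    using B [OF xy(1)] by auto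
  have "g x * h x - g y * h y = g x * (h x - h y) + h y * (g x - g y)"
    by (simp add: algebra_simps)
  then have "\<bar>g x * h x - g y * h y\<bar> \<le> \<bar>g x\<bar> * \<bar>h x - h y\<bar> + \<bar>h y\<bar> * \<bar>g x - g y\<bar>"
    by (metis abs_mult abs_triangle_ineq)
  also have "\<dots> \<le> B * (M * D) + C * (L * D)"
    using Lipschitz_nsphereD [OF assms(1) xy] Lipschitz_nsphereD [OF assms(2) xy] B xy \<open>B \<ge> 0\<close> \<open>C \<ge> 0\<close>
    unfolding D_def by (intro add_mono mult_mono) auto
  finally show "\<bar>g x * h x - g y * h y\<bar> \<le> (B * M + C * L) * (\<Sum>j\<le>n. \<bar>x j - y j\<bar>)"
    by (simp add: algebra_simps D_def)
qed

lemma Lipschitz_nsphere_reflect: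
  assumes "Lipschitz_nsphere n L g"
  shows "Lipschitz_nsphere n L (\<lambda>x. g (- x))"
  unfolding Lipschitz_nsphere_def
proof (intro ballI)
  fix x y assume "x \<in> topspace (nsphere n)" "y \<in> topspace (nsphere n)"
  then have "\<bar>g (- x) - g (- y)\<bar> \<le> L * (\<Sum>j\<le>n. \<bar>(- x) j - (- y) j\<bar>)"
    by (intro Lipschitz_nsphereD [OF assms]) simp_all
  then show "\<bar>g (- x) - g (- y)\<bar> \<le> L * (\<Sum>j\<le>n. \<bar>x j - y j\<bar>)"
    by (simp add: abs_minus_commute)
qed

lemma Lipschitz_nsphere_imp_continuous_on:
  assumes "Lipschitz_nsphere n L g"
  shows "continuous_on (topspace (nsphere n)) g"
  unfolding continuous_on_def
proof
  fix x assume x: "x \<in> topspace (nsphere n)"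
  define D where "D y = (\<Sum>j\<le>n. \<bar>y j - x j\<bar>)" for y :: "nat \<Rightarrow> real"
  have "continuous_on (topspace (nsphere n)) (\<lambda>y. L * D y)"
    unfolding D_def by (intro continuous_intros continuous_on_coordinate)
  then have "((\<lambda>y. L * D y) \<longlongrightarrow> L * D x) (at x within topspace (nsphere n))"
    using x by (simp add: continuous_on_def)
  then have lim: "((\<lambda>y. L * D y) \<longlongrightarrow> 0) (at x within topspace (nsphere n))"
    by (simp add: D_def)
  have "\<forall>\<^sub>F y in at x within topspace (nsphere n). norm (g y - g x) \<le> L * D y"
    using Lipschitz_nsphereD [OF assms _ x] by (simp add: eventually_at_filter D_def)
  then have "((\<lambda>y. g y - g x) \<longlongrightarrow> 0) (at x within topspace (nsphere n))"
    using lim by (rule Lim_null_comparison)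
  then show "(g \<longlongrightarrow> g x) (at x within topspace (nsphere n))"
    by (simp add: LIM_zero_iff)
qed

text \<open>Stone-Weierstrass: the Lipschitz functions form an algebra that contains the constants
  and separates points by coordinates. Closure under products uses boundedness on the compact
  sphere.\<close>

lemma Lipschitz_approximation_nsphere:
  fixes f :: "(nat \<Rightarrow> real) \<Rightarrow> real"
  assumes "continuous_on (topspace (nsphere n)) f" "e > 0"
  shows "\<exists>g. (\<exists>L. Lipschitz_nsphere n L g) \<and> (\<forall>x\<in>topspace (nsphere n). \<bar>f x - g x\<bar> < e)"
proof (rule Stone_Weierstrass_HOL [OF compact_nsphere])
  show "\<exists>L. Lipschitz_nsphere n L (\<lambda>x. c)" for c
    by (auto simp: Lipschitz_nsphere_def intro: exI [of _ 0])
  show "continuous_on (topspace (nsphere n)) g" if "\<exists>L. Lipschitz_nsphere n L g" for g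
    using that Lipschitz_nsphere_imp_continuous_on by blast
  show "\<exists>L. Lipschitz_nsphere n L (\<lambda>x. g x + h x)"
    if "(\<exists>L. Lipschitz_nsphere n L g) \<and> (\<exists>L. Lipschitz_nsphere n L h)" for g h
    using that Lipschitz_nsphere_add by blast
  show "\<exists>L. Lipschitz_nsphere n L (\<lambda>x. g x * h x)"
    if gh: "(\<exists>L. Lipschitz_nsphere n L g) \<and> (\<exists>L. Lipschitz_nsphere n L h)" for g h
  proof -
    have bounded: "\<exists>B. \<forall>x\<in>topspace (nsphere n). \<bar>u x\<bar> \<le> B" if "Lipschitz_nsphere n L u" for u L
      using compact_continuous_image [OF Lipschitz_nsphere_imp_continuous_on [OF that] compact_nsphere]
      by (auto dest!: compact_imp_bounded simp: bounded_iff)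
    obtain L M where LM: "Lipschitz_nsphere n L g" "Lipschitz_nsphere n M h"
      using gh by blast
    obtain B where "\<forall>x\<in>topspace (nsphere n). \<bar>g x\<bar> \<le> B"
      using bounded [OF LM(1)] by blast
    moreover obtain C where "\<forall>x\<in>topspace (nsphere n). \<bar>h x\<bar> \<le> C"
      using bounded [OF LM(2)] by blast
    ultimately show ?thesis
      using Lipschitz_nsphere_mult [OF LM] by blast
  qed
  show "\<exists>g. (\<exists>L. Lipschitz_nsphere n L g) \<and> g x \<noteq> g y"
    if xy: "x \<in> topspace (nsphere n) \<and> y \<in> topspace (nsphere n) \<and> x \<noteq> y" for x y
  proof -
    obtain i where i: "x i \<noteq> y i"
      using xy by (meson ext)
    have "i \<le> n"
    proof (rule ccontr)
      assume "\<not> i \<le> n"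
      then have "x i = 0" "y i = 0"
        using xy by (auto simp: topspace_nsphere)
      with i show False by simp
    qed
    then have "\<bar>u i - v i\<bar> \<le> (\<Sum>j\<le>n. \<bar>u j - v j\<bar>)" for u v :: "nat \<Rightarrow> real"
      by (intro member_le_sum [where f = "\<lambda>j. \<bar>u j - v j\<bar>"]) auto
    then have "Lipschitz_nsphere n 1 (\<lambda>u. u i)"
      by (simp add: Lipschitz_nsphere_def)
    with i show ?thesis
      by blast
  qed
qed (use assms in auto)

text \<open>Approximate each coordinate and take the odd part. As \<open>f\<close> is odd, averaging
  the errors at \<open>x\<close> and \<open>- x\<close> keeps them below \<open>e\<close>.\<close>

lemma odd_map_approximation:
  fixes f :: "(nat \<Rightarrow> real) \<Rightarrow> nat \<Rightarrow> real"
  assumes cont: "\<And>i. i \<le> n \<Longrightarrow> continuous_on (topspace (nsphere n)) (\<lambda>x. f x i)" and "e > 0"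
    and odd: "\<And>x. x \<in> topspace (nsphere n) \<Longrightarrow> f (- x) = - f x"
  obtains g L where "\<And>i. i \<le> n \<Longrightarrow> Lipschitz_nsphere n L (\<lambda>x. g x i)"
    "\<And>i x. \<lbrakk>i \<le> n; x \<in> topspace (nsphere n)\<rbrakk> \<Longrightarrow> \<bar>f x i - g x i\<bar> < e"
    "\<And>x. g (- x) = - g x"
proof -
  have "\<exists>g L. Lipschitz_nsphere n L g \<and> (\<forall>x\<in>topspace (nsphere n). \<bar>f x i - g x\<bar> < e)"
    if "i \<le> n" for i
    using Lipschitz_approximation_nsphere [OF cont [OF that] \<open>e > 0\<close>] by blast
  then obtain h L where lip: "\<And>i. i \<le> n \<Longrightarrow> Lipschitz_nsphere n (L i) (h i)"
    and near: "\<And>i x. \<lbrakk>i \<le> n; x \<in> topspace (nsphere n)\<rbrakk> \<Longrightarrow> \<bar>f x i - h i x\<bar> < e"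
    by metis
  define g where "g x i = (h i x - h i (- x)) / 2" for x i
  define M where "M = (\<Sum>i\<le>n. \<bar>L i\<bar>)"
  have "Lipschitz_nsphere n M (\<lambda>x. g x i)" if "i \<le> n" for i
    unfolding Lipschitz_nsphere_def
  proof (intro ballI)
    fix x y assume xy: "x \<in> topspace (nsphere n)" "y \<in> topspace (nsphere n)"
    have "L i \<le> \<bar>L i\<bar>" "\<bar>L i\<bar> \<le> M"
      unfolding M_def using that by (auto intro!: member_le_sum)
    then have M: "Lipschitz_nsphere n M (h i)"
      using lip [OF that] Lipschitz_nsphere_mono by fastforce
    have half: "\<bar>(a - a') / 2 - (b - b') / 2\<bar> \<le> B" if "\<bar>a - b\<bar> \<le> B" "\<bar>a' - b'\<bar> \<le> B" for a a' b b' B :: real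
      using that by (simp add: abs_le_iff field_simps)
    show "\<bar>g x i - g y i\<bar> \<le> M * (\<Sum>j\<le>n. \<bar>x j - y j\<bar>)"
      using Lipschitz_nsphereD [OF M xy]
        Lipschitz_nsphereD [OF Lipschitz_nsphere_reflect [OF M] xy]
      unfolding g_def by (rule half)
  qed
  moreover have "\<bar>f x i - g x i\<bar> < e" if "i \<le> n" "x \<in> topspace (nsphere n)" for i x
  proof -
    have "- x \<in> topspace (nsphere n)" "f (- x) i = - f x i"
      using that odd by auto
    then show ?thesis
      using near [OF that] near [OF that(1), of "- x"]
      by (simp add: g_def abs_less_iff field_simps)
  qed
  moreover have "g (- x) = - g x" for x
    by (rule ext) (simp add: g_def minus_divide_left)
  ultimately show thesis
    by (rule that)
qed

section \<open>Odd maps have odd degree\<close>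

text \<open>The 0-sphere has two points, so the map is the identity or the swap. The swap is the
  reflection in coordinate 0, and the degree is 1 or -1.\<close>

lemma odd_Brouwer_degree2_0:
  assumes "f \<in> topspace (nsphere 0) \<rightarrow> topspace (nsphere 0)"
    and odd: "\<And>x. x \<in> topspace (nsphere 0) \<Longrightarrow> f (- x) = - f x"
  shows "odd (Brouwer_degree2 0 f)"
proof -
  define u where "u = (\<lambda>i::nat. if i = 0 then 1 else 0 :: real)"
  have S0: "x = u \<or> x = - u" if "x \<in> topspace (nsphere 0)" for x
    using that by (auto simp: topspace_nsphere u_def fun_eq_iff power2_eq_1_iff)
  have u: "u \<in> topspace (nsphere 0)"
    by (simp add: topspace_nsphere u_def)
  then have "f u = u \<or> f u = - u"
    using assms(1) S0 by blast
  then show ?thesis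
  proof
    assume "f u = u"
    then have "f x = id x" if "x \<in> topspace (nsphere 0)" for x
      using S0 [OF that] odd [OF u] by auto
    then have "Brouwer_degree2 0 f = Brouwer_degree2 0 id"
      by (rule Brouwer_degree2_eq)
    then show ?thesis by simp
  next
    assume "f u = - u"
    then have "f x = - x" if "x \<in> topspace (nsphere 0)" for x
      using S0 [OF that] odd [OF u] by auto
    moreover have "- x = (\<lambda>i. if i = 0 then - x i else x i)" if "x \<in> topspace (nsphere 0)" for x
      using that by (auto simp: topspace_nsphere fun_eq_iff)
    ultimately have "f x = (\<lambda>i. if i = 0 then - x i else x i)" if "x \<in> topspace (nsphere 0)" for x
      using that by simp
    then have "Brouwer_degree2 0 f = Brouwer_degree2 0 (\<lambda>x i. if i = 0 then - x i else x i)"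
      by (rule Brouwer_degree2_eq)
    then show ?thesis
      by (simp add: Brouwer_degree2_reflection)
  qed
qed

text \<open>This makes induction on the dimension possible: the new map restricts to an odd self-map
  of the equator and has the same degree as \<open>f\<close>.\<close>

lemma odd_map_homotopic_equator_preserving:
  assumes cont: "continuous_map (nsphere (Suc p)) (nsphere (Suc p)) f"
    and odd: "\<And>x. x \<in> topspace (nsphere (Suc p)) \<Longrightarrow> f (- x) = - f x"
  obtains g where "continuous_map (nsphere (Suc p)) (nsphere (Suc p)) g"
    "\<And>x. g (- x) = - g x"
    "g \<in> topspace (nsphere p) \<rightarrow> topspace (nsphere p)"
    "Brouwer_degree2 (Suc p) g = Brouwer_degree2 (Suc p) f"
proof -
  define n where "n = Suc p"
  define S where "S = topspace (nsphere n)"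
  \<comment> \<open>Half the lower bound for the largest coordinate of a point of the
    \<open>n\<close>-sphere: an error below \<open>\<delta>\<close> leaves that coordinate of size
    at least \<open>\<delta>\<close>.\<close>
  define \<delta> where "\<delta> = 1 / (2 * (real n + 1))"
  have "\<delta> > 0"
    by (simp add: \<delta>_def)
  have contf: "continuous_on S f" and fS: "\<And>x. x \<in> S \<Longrightarrow> f x \<in> S"
    using cont by (auto simp: continuous_map_nsphere_iff n_def S_def)
  have contfi: "continuous_on S (\<lambda>x. f x i)" for i
    using continuous_on_product_then_coordinatewise [OF contf] .
  obtain G L where lip: "\<And>i. i \<le> n \<Longrightarrow> Lipschitz_nsphere n L (\<lambda>x. G x i)"
    and near: "\<And>i x. \<lbrakk>i \<le> n; x \<in> S\<rbrakk> \<Longrightarrow> \<bar>f x i - G x i\<bar> < \<delta>"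
    and Godd: "\<And>x. G (- x) = - G x"
    using odd_map_approximation [of n f \<delta>] contfi \<open>\<delta> > 0\<close> odd unfolding S_def n_def by metis
  have contG: "continuous_on S (\<lambda>x. G x i)" if "i \<le> n" for i
    using Lipschitz_nsphere_imp_continuous_on [OF lip [OF that]] by (simp add: S_def)
  have large: "\<exists>k\<le>n. \<bar>f x k\<bar> \<ge> 2 * \<delta>" if "x \<in> S" for x
  proof -
    have "f x \<in> topspace (nsphere n)"
      using fS [OF that] by (simp add: S_def)
    then obtain k where "k \<le> n" "\<bar>f x k\<bar> \<ge> 1 / (n + 1)"
      by (rule nsphere_large_coordinate)
    then show ?thesis
      by (intro exI [of _ k]) (simp add: \<delta>_def field_simps)
  qed
  have Gnz: "\<exists>k\<le>n. \<bar>G x k\<bar> \<ge> \<delta>" if x: "x \<in> S" for x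
  proof -
    obtain k where "k \<le> n" "\<bar>f x k\<bar> \<ge> 2 * \<delta>"
      using large [OF x] by blast
    then show ?thesis
      using near [OF _ x, of k] by (intro exI [of _ k]) linarith
  qed
  have Sp: "topspace (nsphere p) \<subseteq> S"
    unfolding S_def n_def by (intro topspace_nsphere_mono) simp
  obtain c where c: "\<And>x. x \<in> topspace (nsphere p) \<Longrightarrow> \<exists>i\<le>p. G x i \<noteq> c i * G x (Suc p)"
  proof (rule Lipschitz_nsphere_avoids_direction [of p G L \<delta>])
    fix i x y assume i: "i \<le> Suc p" and xy: "x \<in> topspace (nsphere p)" "y \<in> topspace (nsphere p)"
    then have "x n = 0" "y n = 0"
      by (auto simp: topspace_nsphere n_def)
    moreover have "\<bar>G x i - G y i\<bar> \<le> L * (\<Sum>j\<le>n. \<bar>x j - y j\<bar>)"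
      using Lipschitz_nsphereD [OF lip] i xy Sp by (auto simp: n_def S_def)
    ultimately show "\<bar>G x i - G y i\<bar> \<le> L * (\<Sum>j\<le>p. \<bar>x j - y j\<bar>)"
      by (simp add: n_def)
  next
    show "\<exists>i\<le>Suc p. \<delta> \<le> \<bar>G x i\<bar>" if "x \<in> topspace (nsphere p)" for x
      using Gnz Sp that by (auto simp: n_def)
  qed (use \<open>\<delta> > 0\<close> that in auto)
  note continuous_on_compose_snd = continuous_on_compose2 [OF _ continuous_on_snd [OF continuous_on_id]]
  have contf2: "continuous_on ({0..1::real} \<times> S) (\<lambda>q. f (snd q) i)" for i
    by (rule continuous_on_compose_snd [OF contfi]) auto
  have contG2: "continuous_on ({0..1::real} \<times> S) (\<lambda>q. G (snd q) i)" if "i \<le> n" for i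
    by (rule continuous_on_compose_snd [OF contG [OF that]]) auto
  have contx2: "continuous_on ({0..1::real} \<times> S) (\<lambda>q. snd q i)" for i
    by (rule continuous_on_compose_snd [OF continuous_on_coordinate [of S]]) auto
  text \<open>
    \<open>H1\<close> is the straight line from \<open>f\<close> to \<open>G\<close>; \<open>H2\<close> is a shear moving the missed direction \<open>(c, 1)\<close> to
    the \<open>n\<close>-th axis; \<open>H3\<close> flattens the last coordinate on the equator \<open>x n = 0\<close>.
  \<close>
  define H1 where "H1 t x i = (1 - t) * f x i + t * G x i" for t x i
  define H2 where "H2 t x i = (if i < n then G x i - t * c i * G x n else G x i)" for t x i
  define H3 where "H3 t x i = (if i < n then H2 1 x i else ((1 - t) + t * \<bar>x n\<bar>) * G x i)" for t x i
  \<comment> \<open>The last coordinate is suppressed only for \<open>t = 1\<close> on the equator,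
    where the choice of \<open>c\<close> makes another one nonzero. Otherwise its factor is
    positive, and a zero of \<open>H3\<close> would be a zero of \<open>G\<close>.\<close>
  have H3_nz: "\<exists>k\<le>n. H3 t x k \<noteq> 0" if "t \<in> {0..1}" and x: "x \<in> S" for t x
  proof (cases "t = 1 \<and> x n = 0")
    case True
    then have "x \<in> topspace (nsphere p)"
      using topspace_nsphere_minus1 [of x n] \<open>x \<in> S\<close> by (simp add: S_def n_def)
    then obtain i where "i \<le> p" "G x i \<noteq> c i * G x (Suc p)"
      using c by blast
    then show ?thesis
      by (intro exI [of _ i]) (auto simp: H3_def H2_def n_def)
  next
    case False
    then have pos: "(1 - t) + t * \<bar>x n\<bar> > 0"
      using that(1) by (cases "t = 1") (auto intro: add_pos_nonneg)
    show ?thesis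
    proof (rule ccontr)
      assume "\<not> ?thesis"
      then have zero: "H3 t x k = 0" if "k \<le> n" for k
        using that by blast
      have "G x n = 0"
        using zero [of n] pos by (simp add: H3_def)
      then have "G x k = 0" if "k \<le> n" for k
        using zero [OF that] pos by (simp add: H3_def H2_def split: if_splits)
      then show False
        using Gnz [OF x] \<open>\<delta> > 0\<close> by force
    qed
  qed
  have "Brouwer_degree2 n (\<lambda>x. sphere_projection n (H1 0 x)) =
        Brouwer_degree2 n (\<lambda>x. sphere_projection n (H1 1 x))"
  proof (rule Brouwer_degree2_sphere_projection_homotopic; fold S_def)
    show "continuous_on ({0..1} \<times> S) (\<lambda>q. H1 (fst q) (snd q) k)" if "k \<le> n" for k
      unfolding H1_def by (intro continuous_intros contf2 contG2 that)
    show "\<exists>k\<le>n. H1 t x k \<noteq> 0" if "t \<in> {0..1}" and x: "x \<in> S" for t x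
    proof -
      obtain k where k: "k \<le> n" "\<bar>f x k\<bar> \<ge> 2 * \<delta>"
        using large [OF x] by blast
      have "t * \<bar>f x k - G x k\<bar> \<le> 1 * \<delta>"
        using near [OF k(1) x] that(1) by (intro mult_mono) auto
      then have "\<bar>t * (f x k - G x k)\<bar> \<le> \<delta>"
        using that(1) by (simp add: abs_mult)
      moreover have "H1 t x k = f x k - t * (f x k - G x k)"
        by (simp add: H1_def algebra_simps)
      ultimately have "H1 t x k \<noteq> 0"
        using k(2) \<open>\<delta> > 0\<close> by linarith
      with k show ?thesis by blast
    qed
  qed
  moreover have "sphere_projection n (H1 0 x) = f x" if "x \<in> S" for x
  proof -
    have "H1 0 x = f x"
      by (simp add: H1_def fun_eq_iff)
    then show ?thesis
      using sphere_projection_id [of "f x" n] fS [OF that] by (simp add: S_def)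
  qed
  ultimately have "Brouwer_degree2 n f = Brouwer_degree2 n (\<lambda>x. sphere_projection n (H1 1 x))"
    using Brouwer_degree2_eq [of n f] by (metis (no_types, lifting) S_def)
  also have "H1 1 = H2 0"
    by (simp add: H1_def H2_def fun_eq_iff)
  also have "Brouwer_degree2 n (\<lambda>x. sphere_projection n (H2 0 x)) =
        Brouwer_degree2 n (\<lambda>x. sphere_projection n (H2 1 x))"
  proof (rule Brouwer_degree2_sphere_projection_homotopic; fold S_def)
    show "continuous_on ({0..1} \<times> S) (\<lambda>q. H2 (fst q) (snd q) k)" if "k \<le> n" for k
      using that unfolding H2_def by (cases "k < n") (auto intro!: continuous_intros contG2)
    show "\<exists>k\<le>n. H2 t x k \<noteq> 0" if "t \<in> {0..1}" and x: "x \<in> S" for t x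
    proof (rule ccontr)
      assume "\<not> ?thesis"
      then have zero: "H2 t x k = 0" if "k \<le> n" for k
        using that by blast
      have "G x n = 0"
        using zero [of n] by (simp add: H2_def)
      then have "G x k = 0" if "k \<le> n" for k
        using zero [OF that] by (simp add: H2_def split: if_splits)
      then show False
        using Gnz [OF x] \<open>\<delta> > 0\<close> by force
    qed
  qed
  also have "H2 1 = H3 0"
    by (simp add: H2_def H3_def fun_eq_iff)
  also have "Brouwer_degree2 n (\<lambda>x. sphere_projection n (H3 0 x)) =
        Brouwer_degree2 n (\<lambda>x. sphere_projection n (H3 1 x))"
  proof (rule Brouwer_degree2_sphere_projection_homotopic; fold S_def)
    show "continuous_on ({0..1} \<times> S) (\<lambda>q. H3 (fst q) (snd q) k)" if "k \<le> n" for k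
      using that unfolding H3_def H2_def by (cases "k < n") (auto intro!: continuous_intros contG2 contx2)
    show "\<exists>k\<le>n. H3 t x k \<noteq> 0" if "t \<in> {0..1}" "x \<in> S" for t x
      using H3_nz that by blast
  qed
  finally have deg: "Brouwer_degree2 n f = Brouwer_degree2 n (\<lambda>x. sphere_projection n (H3 1 x))" .
  show thesis
  proof
    have "continuous_on S (\<lambda>x. H3 1 x k)" if "k \<le> n" for k
      using that unfolding H3_def H2_def
      by (cases "k < n") (auto intro!: continuous_intros contG continuous_on_coordinate)
    then have "continuous_on S (\<lambda>x. sphere_projection n (H3 1 x))"
      by (rule continuous_on_sphere_projection) (use H3_nz [of 1] in auto)
    moreover have "sphere_projection n (H3 1 x) \<in> S" if "x \<in> S" for x
      using H3_nz [of 1 x] that sphere_projection_in_nsphere unfolding S_def by auto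
    ultimately show cont: "continuous_map (nsphere (Suc p)) (nsphere (Suc p)) (\<lambda>x. sphere_projection n (H3 1 x))"
      by (simp add: continuous_map_nsphere_iff flip: n_def S_def)
    show "(\<lambda>x. sphere_projection n (H3 1 x)) \<in> topspace (nsphere p) \<rightarrow> topspace (nsphere p)"
    proof
      fix x assume x: "x \<in> topspace (nsphere p)"
      then have "x n = 0" "x \<in> S"
        using Sp by (auto simp: topspace_nsphere n_def)
      then have "sphere_projection n (H3 1 x) n = 0"
        by (simp add: sphere_projection_def H3_def)
      moreover have "sphere_projection n (H3 1 x) \<in> topspace (nsphere n)"
        using H3_nz [of 1 x] \<open>x \<in> S\<close> sphere_projection_in_nsphere by auto
      ultimately show "sphere_projection n (H3 1 x) \<in> topspace (nsphere p)"
        using topspace_nsphere_minus1 [of _ n] by (simp add: n_def)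
    qed
    show "sphere_projection n (H3 1 (- x)) = - sphere_projection n (H3 1 x)" for x
    proof -
      \<comment> \<open>The flattening factor \<open>\<bar>x n\<bar>\<close> is even, so multiplying
        by it preserves oddness.\<close>
      have "H3 1 (- x) = - H3 1 x"
        by (auto simp: H3_def H2_def Godd fun_eq_iff)
      then show ?thesis
        by (simp add: sphere_projection_uminus)
    qed
    show "Brouwer_degree2 (Suc p) (\<lambda>x. sphere_projection n (H3 1 x)) = Brouwer_degree2 (Suc p) f"
      using deg by (simp add: n_def)
  qed
qed

theorem odd_map_odd_Brouwer_degree2:
  assumes "continuous_map (nsphere n) (nsphere n) f"
    and "\<And>x. x \<in> topspace (nsphere n) \<Longrightarrow> f (- x) = - f x"
  shows "odd (Brouwer_degree2 n f)"
  using assms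
proof (induction n arbitrary: f)
  case 0
  then show ?case
    by (intro odd_Brouwer_degree2_0) (auto simp: continuous_map_nsphere_iff)
next
  case (Suc p)
  obtain g where contg: "continuous_map (nsphere (Suc p)) (nsphere (Suc p)) g"
    and odd: "\<And>x. g (- x) = - g x"
    and equator: "g \<in> topspace (nsphere p) \<rightarrow> topspace (nsphere p)"
    and deg: "Brouwer_degree2 (Suc p) g = Brouwer_degree2 (Suc p) f"
    using odd_map_homotopic_equator_preserving [OF Suc.prems] by metis
  have "continuous_map (nsphere p) (nsphere p) g"
    using contg equator topspace_nsphere_mono [of p "Suc p"] continuous_on_subset
    by (fastforce simp: continuous_map_nsphere_iff)
  then have "odd (Brouwer_degree2 p g)"
    using Suc.IH odd by blast
  \<comment> \<open>For an odd map preserving the equator, the degrees on the sphere and on the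
    equator have the same parity.\<close>
  moreover have "even (Brouwer_degree2 (Suc p) g - Brouwer_degree2 (Suc p - Suc 0) g)"
    using contg equator odd by (intro Borsuk_odd_mapping_degree_step) (simp_all add: fun_Compl_def)
  ultimately show ?case
    by (simp add: deg)
qed

section \<open>The Borsuk-Ulam theorem and antipodal covers\<close>

text \<open>Without a zero, \<open>F\<close> padded by a zero coordinate and normalised would be an
  odd self-map of the \<open>d\<close>-sphere missing the pole. Its degree would be 0, yet also
  odd.\<close>

theorem Borsuk_Ulam_nsphere:
  fixes F :: "(nat \<Rightarrow> real) \<Rightarrow> nat \<Rightarrow> real"
  assumes cont: "\<And>i. i < d \<Longrightarrow> continuous_on (topspace (nsphere d)) (\<lambda>x. F x i)"
    and odd: "\<And>i x. \<lbrakk>i < d; x \<in> topspace (nsphere d)\<rbrakk> \<Longrightarrow> F (- x) i = - F x i"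
  shows "\<exists>x\<in>topspace (nsphere d). \<forall>i<d. F x i = 0"
proof (rule ccontr)
  assume no_zero: "\<not> ?thesis"
  have nz: "\<exists>i<d. F x i \<noteq> 0" if "x \<in> topspace (nsphere d)" for x
    using that no_zero by blast
  define g where "g x i = (if i < d then F x i else 0)" for x i
  define f where "f x = sphere_projection d (g x)" for x
  have g_nz: "\<exists>i\<le>d. g x i \<noteq> 0" if "x \<in> topspace (nsphere d)" for x
    using nz [OF that] by (auto simp: g_def intro: less_imp_le)
  have "continuous_on (topspace (nsphere d)) f"
    unfolding f_def
  proof (rule continuous_on_sphere_projection)
    show "continuous_on (topspace (nsphere d)) (\<lambda>x. g x k)" for k
      using cont by (cases "k < d") (auto simp: g_def)
  qed (rule g_nz)
  moreover have f_in: "f x \<in> topspace (nsphere d)" if "x \<in> topspace (nsphere d)" for x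
    using g_nz [OF that] sphere_projection_in_nsphere by (auto simp: f_def)
  ultimately have contf: "continuous_map (nsphere d) (nsphere d) f"
    by (simp add: continuous_map_nsphere_iff)
  have "g (- x) = - g x" if "x \<in> topspace (nsphere d)" for x
    using odd that by (auto simp: g_def fun_eq_iff)
  then have "odd (Brouwer_degree2 d f)"
    using contf by (intro odd_map_odd_Brouwer_degree2) (auto simp: f_def sphere_projection_uminus)
  moreover have "f x d = 0" for x
    by (simp add: f_def sphere_projection_def g_def)
  then have "(\<lambda>i. if i = d then 1 else 0) \<notin> f ` topspace (nsphere d)"
    by (auto dest: fun_cong [of _ _ d])
  moreover have "(\<lambda>i. if i = d then 1 else 0) \<in> topspace (nsphere d)"
    by (simp add: topspace_nsphere if_distrib [where f = "\<lambda>x. x ^ 2"] cong: if_cong)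
  ultimately have "Brouwer_degree2 d f = 0" "odd (Brouwer_degree2 d f)"
    using Brouwer_degree2_nonsurjective [OF contf] by auto
  then show False
    by simp
qed

text \<open>The argument of Radon's theorem: the positive and negative coefficients have the same
  total up to sign. Dividing by that total gives one point as a convex combination on either
  side.\<close>

lemma Radon_convex_hulls_intersect:
  fixes x :: "'i \<Rightarrow> 'a::real_vector"
  assumes "finite I" and sum0: "(\<Sum>i\<in>I. f i) = 0" and "(\<Sum>i\<in>I. f i *\<^sub>R x i) = 0"
    and k: "k \<in> I" "f k \<noteq> 0"
  shows "convex hull (x ` {i \<in> I. f i > 0}) \<inter> convex hull (x ` {i \<in> I. f i < 0}) \<noteq> {}"
proof -
  define P where "P = {i \<in> I. f i > 0}"
  define Q where "Q = {i \<in> I. f i < 0}"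
  have PQ: "finite P" "finite Q"
    using \<open>finite I\<close> by (auto simp: P_def Q_def)
  have disjoint: "P \<inter> Q = {}"
    unfolding P_def Q_def using less_asym by blast
  have split: "(\<Sum>i\<in>I. h i) = (\<Sum>i\<in>P. h i) + (\<Sum>i\<in>Q. h i)"
    if "\<And>i. f i = 0 \<Longrightarrow> h i = 0" for h :: "'i \<Rightarrow> 'b::comm_monoid_add"
  proof -
    have "(\<Sum>i\<in>I. h i) = (\<Sum>i\<in>P \<union> Q. h i)"
    proof (rule sum.mono_neutral_right)
      show "\<forall>i\<in>I - (P \<union> Q). h i = 0"
      proof
        fix i assume "i \<in> I - (P \<union> Q)"
        then have "f i = 0"
          unfolding P_def Q_def by (auto simp: not_less intro: antisym)
        then show "h i = 0"
          by (rule that)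
      qed
    qed (use \<open>finite I\<close> in \<open>auto simp: P_def Q_def\<close>)
    also have "\<dots> = (\<Sum>i\<in>P. h i) + (\<Sum>i\<in>Q. h i)"
      by (rule sum.union_disjoint [OF PQ disjoint])
    finally show ?thesis .
  qed
  define s where "s = (\<Sum>i\<in>P. f i)"
  have sQ: "s = (\<Sum>i\<in>Q. - f i)"
    using sum0 split [of f] by (simp add: s_def sum_negf)
  \<comment> \<open>The nonzero \<open>f k\<close> contributes a positive term to one of the two
    expressions for \<open>s\<close>.\<close>
  have "s > 0"
  proof (cases "f k > 0")
    case True
    then show ?thesis
      unfolding s_def using k PQ by (intro sum_pos2 [of _ k]) (auto simp: P_def)
  next
    case False
    then show ?thesis
      unfolding sQ using k PQ by (intro sum_pos2 [of _ k]) (auto simp: Q_def)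
  qed
  define y where "y = (\<Sum>i\<in>P. (f i / s) *\<^sub>R x i)"
  have "(\<Sum>i\<in>P. f i *\<^sub>R x i) = - (\<Sum>i\<in>Q. f i *\<^sub>R x i)"
    using assms(3) split [of "\<lambda>i. f i *\<^sub>R x i"] by (simp add: eq_neg_iff_add_eq_0)
  then have "(1 / s) *\<^sub>R (\<Sum>i\<in>P. f i *\<^sub>R x i) = (1 / s) *\<^sub>R (\<Sum>i\<in>Q. - f i *\<^sub>R x i)"
    by (simp add: sum_negf)
  then have y_eq: "y = (\<Sum>i\<in>Q. (- f i / s) *\<^sub>R x i)"
    unfolding y_def scaleR_sum_right by simp
  have "y \<in> convex hull (x ` P)"
    unfolding y_def using PQ \<open>s > 0\<close>
    by (intro convex_sum [OF _ convex_convex_hull])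
      (auto simp: P_def s_def hull_inc simp flip: sum_divide_distrib)
  moreover have "y \<in> convex hull (x ` Q)"
    unfolding y_eq
  proof (intro convex_sum [OF _ convex_convex_hull])
    show "(\<Sum>i\<in>Q. - f i / s) = 1"
      unfolding sum_divide_distrib [symmetric] sQ [symmetric] using \<open>s > 0\<close> by simp
  qed (use PQ \<open>s > 0\<close> in \<open>auto simp: Q_def hull_inc field_simps\<close>)
  ultimately show ?thesis
    unfolding P_def Q_def by blast
qed

lemma sum_fun_apply: "(\<Sum>i\<in>I. h i) k = (\<Sum>i\<in>I. h i k)"
  by (induction I rule: infinite_finite_induct) auto

lemma symmetric_cover_approximate_intersection:
  fixes x :: "nat \<Rightarrow> nat \<Rightarrow> real" and A :: "nat \<Rightarrow> (nat \<Rightarrow> real) set"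
  assumes "d \<ge> 1" "finite I"
    and x: "\<And>i. i \<in> I \<Longrightarrow> x i \<in> topspace (Euclidean_space (d - 1))"
    and closed: "\<And>i. i \<in> I \<Longrightarrow> closed (A i)"
    and antipodal: "\<And>i. i \<in> I \<Longrightarrow> A i \<inter> uminus ` A i = {}"
    and cover: "topspace (nsphere d) \<subseteq> (\<Union>i\<in>I. A i) \<union> (\<Union>i\<in>I. uminus ` A i)"
    and "e > 0"
  obtains z P Q where "z \<in> topspace (nsphere d)" "P \<subseteq> I" "Q \<subseteq> I" "P \<inter> Q = {}"
    "convex hull (x ` P) \<inter> convex hull (x ` Q) \<noteq> {}"
    "\<forall>i\<in>P. A i \<noteq> {} \<and> infdist z (A i) < e" "\<forall>i\<in>Q. A i \<noteq> {} \<and> infdist (- z) (A i) < e"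
proof -
  define g where "g i z = max 0 (e - infdist z (A i))" for i z
  define f where "f i z = g i z - g i (- z)" for i z
  \<comment> \<open>The points use coordinates \<open>0\<close> to \<open>d - 2\<close>, which
    leaves coordinate \<open>d - 1\<close> free for the sum of the coefficients: \<open>d\<close>
    equations in all, as Borsuk-Ulam permits.\<close>
  define F where "F z k = (if k = d - 1 then \<Sum>i\<in>I. f i z else \<Sum>i\<in>I. f i z * x i k)" for z k
  have cont: "continuous_on S (f i)" for i S
  proof -
    have "continuous_on S (\<lambda>z. infdist z (A i))" "continuous_on S (\<lambda>z. infdist (- z) (A i))"
      by (intro continuous_on_infdist continuous_on_uminus_fun continuous_on_id)+
    then show ?thesis
      unfolding f_def g_def by (intro continuous_on_diff continuous_on_max continuous_on_const)
  qed
  have "\<exists>z\<in>topspace (nsphere d). \<forall>k<d. F z k = 0"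
  proof (rule Borsuk_Ulam_nsphere )
    show "continuous_on (topspace (nsphere d)) (\<lambda>z. F z k)" for k
      unfolding F_def by (cases "k = d - 1") (auto intro!: continuous_intros cont)
    have "f i (- z) = - f i z" for i z
      by (simp add: f_def)
    then show "F (- z) k = - F z k" for k z
      by (simp add: F_def sum_negf)
  qed
  then obtain z where z: "z \<in> topspace (nsphere d)" and Fz: "\<And>k. k < d \<Longrightarrow> F z k = 0"
    by blast
  have sum0: "(\<Sum>i\<in>I. f i z) = 0"
    using Fz [of "d - 1"] \<open>d \<ge> 1\<close> by (simp add: F_def)
  have sumx0: "(\<Sum>i\<in>I. f i z *\<^sub>R x i) = 0"
  proof
    fix k
    have "(\<Sum>i\<in>I. f i z * x i k) = 0"
    proof (cases "k < d - 1")
      case True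
      then show ?thesis
        using Fz [of k] by (simp add: F_def)
    next
      \<comment> \<open>Equality in \<open>nat \<Rightarrow> real\<close> concerns every index; from
        \<open>d - 1\<close> on the points themselves vanish.\<close>
      case False
      then have "x i k = 0" if "i \<in> I" for i
        using x [OF that] by (simp add: topspace_Euclidean_space)
      then show ?thesis by simp
    qed
    then show "(\<Sum>i\<in>I. f i z *\<^sub>R x i) k = 0 k"
      by (simp add: sum_fun_apply scaleR_fun_def)
  qed
  \<comment> \<open>Here \<open>g i w = e\<close>, while \<open>- w\<close> lies outside the closed
    set \<open>A i\<close>, hence at positive distance, so \<open>g i (- w) < e\<close>.\<close>
  have pos: "f i w > 0" if "i \<in> I" "w \<in> A i" for i w
  proof -
    have "- w \<notin> A i"
      using antipodal [OF that(1)] that(2) by force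
    then have "infdist (- w) (A i) \<noteq> 0"
      using in_closed_iff_infdist_zero [OF closed [OF that(1)]] that(2) by blast
    then have "infdist (- w) (A i) > 0"
      using infdist_nonneg [of "- w" "A i"] by linarith
    moreover have "infdist w (A i) = 0"
      using that(2) by simp
    ultimately show ?thesis
      using \<open>e > 0\<close> by (simp add: f_def g_def)
  qed
  have "\<exists>k\<in>I. f k z \<noteq> 0"
  proof -
    obtain i where i: "i \<in> I" "z \<in> A i \<or> z \<in> uminus ` A i"
      using cover z by blast
    then have "z \<in> A i \<or> - z \<in> A i"
      by auto
    moreover have "f i (- z) = - f i z"
      by (simp add: f_def)
    ultimately have "f i z \<noteq> 0"
      using pos [OF i(1), of z] pos [OF i(1), of "- z"] by auto
    then show ?thesis
      using i(1) by blast
  qed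
  then obtain k where "k \<in> I" "f k z \<noteq> 0"
    by blast
  note hulls = Radon_convex_hulls_intersect [OF \<open>finite I\<close> sum0 sumx0 this]
  have close: "A i \<noteq> {} \<and> infdist w (A i) < e" if "f i w > 0" for i w
  proof -
    \<comment> \<open>the distance to the empty set is \<open>0\<close> in the library, so \<open>f i\<close> vanishes identically if \<open>A i\<close> is empty\<close>
    have "A i \<noteq> {}"
      using that by (auto simp: f_def g_def infdist_def)
    moreover have "g i w > 0"
      using that unfolding f_def g_def by linarith
    ultimately show ?thesis
      by (simp add: g_def)
  qed
  show thesis
  proof (rule that [OF z _ _ _ hulls])
    show "\<forall>i\<in>{i \<in> I. f i z < 0}. A i \<noteq> {} \<and> infdist (- z) (A i) < e"
      using close [of _ "- z"] by (simp add: f_def)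
    show "\<forall>i\<in>{i \<in> I. f i z > 0}. A i \<noteq> {} \<and> infdist z (A i) < e"
      using close by blast
  qed auto
qed

theorem theorem1p2:
  fixes d m :: nat
    and X :: "(nat \<Rightarrow> real) set"
    and x :: "nat \<Rightarrow> (nat \<Rightarrow> real)"
    and A :: "nat \<Rightarrow> (nat \<Rightarrow> real) set"
  assumes "d \<ge> 1" and "m \<ge> 1"
    and "X \<subseteq> topspace (Euclidean_space (d - 1))"
    and "X = x ` {1..m}" and "card X = m"
    and "\<And>i. i \<in> {1..m} \<Longrightarrow> closedin (nsphere d) (A i)"
    and "\<And>i. i \<in> {1..m} \<Longrightarrow> A i \<inter> uminus ` A i = {}"
    and "(\<Union>i\<in>{1..m}. A i) \<union> (\<Union>i\<in>{1..m}. uminus ` A i) = topspace (nsphere d)"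
  shows "\<exists>S T. S \<subseteq> {1..m} \<and> T \<subseteq> {1..m} \<and> S \<inter> T = {} \<and>
    convex hull (x ` S) \<inter> convex hull (x ` T) \<noteq> {} \<and>
    (\<Inter>i\<in>S. A i) \<inter> (\<Inter>i\<in>T. uminus ` A i) \<noteq> {}"
proof -
  \<comment> \<open>The sphere is closed in the ambient space, so relative closedness becomes
    absolute, as the \<open>infdist\<close> criterion for membership requires.\<close>
  have closed: "closed (A i)" if "i \<in> {1..m}" for i
    using assms(6) [OF that] compact_imp_closed [OF compact_nsphere]
    by (metis closedin_closed_trans nsphere_eq_top_of_set)
  define approx where "approx n z P Q \<longleftrightarrow> z \<in> topspace (nsphere d) \<and> P \<subseteq> {1..m} \<and> Q \<subseteq> {1..m} \<and>
    P \<inter> Q = {} \<and> convex hull (x ` P) \<inter> convex hull (x ` Q) \<noteq> {} \<and>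
    (\<forall>i\<in>P. A i \<noteq> {} \<and> infdist z (A i) < inverse (real (Suc n))) \<and>
    (\<forall>i\<in>Q. A i \<noteq> {} \<and> infdist (- z) (A i) < inverse (real (Suc n)))" for n z P Q
  have "\<exists>z P Q. approx n z P Q" for n
  proof (rule symmetric_cover_approximate_intersection [of d "{1..m}" x A "inverse (real (Suc n))"])
    show "x i \<in> topspace (Euclidean_space (d - 1))" if "i \<in> {1..m}" for i
      using assms(3,4) that by blast
    show "\<exists>z P Q. approx n z P Q"
      if "z \<in> topspace (nsphere d)" "P \<subseteq> {1..m}" "Q \<subseteq> {1..m}" "P \<inter> Q = {}"
        "convex hull (x ` P) \<inter> convex hull (x ` Q) \<noteq> {}"
        "\<forall>i\<in>P. A i \<noteq> {} \<and> infdist z (A i) < inverse (real (Suc n))"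
        "\<forall>i\<in>Q. A i \<noteq> {} \<and> infdist (- z) (A i) < inverse (real (Suc n))" for z P Q
      using that unfolding approx_def by blast
  qed (use assms closed in auto)
  then obtain z P Q where approx: "\<And>n. approx n (z n) (P n) (Q n)"
    by metis
  have "P n \<in> Pow {1..m}" "Q n \<in> Pow {1..m}" for n
    using approx [of n] unfolding approx_def by blast+
  \<comment> \<open>There are only finitely many pairs of index sets, so one pair occurs for
    infinitely many \<open>n\<close> and can be kept fixed while the points converge.\<close>
  then have "range (\<lambda>n. (P n, Q n)) \<subseteq> Pow {1..m} \<times> Pow {1..m}"
    by blast
  then have "finite (range (\<lambda>n. (P n, Q n)))"
    by (rule finite_subset) simp
  then obtain n\<^sub>0 where inf: "infinite {n. (P n, Q n) = (P n\<^sub>0, Q n\<^sub>0)}"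
    using pigeonhole_infinite [of UNIV "\<lambda>n. (P n, Q n)"] by auto
  obtain s :: "nat \<Rightarrow> nat" where s: "strict_mono s" "\<And>n. s n \<in> {n. (P n, Q n) = (P n\<^sub>0, Q n\<^sub>0)}"
    using infinite_enumerate [OF inf] by blast
  have "seq_compact (topspace (nsphere d))"
    using compact_nsphere compact_eq_seq_compact_metric by blast
  then obtain w r where w: "w \<in> topspace (nsphere d)" and r: "strict_mono r"
    and lim: "((\<lambda>n. z (s n)) \<circ> r) \<longlonglongrightarrow> w"
    using approx unfolding seq_compact_def approx_def by metis
  define t where "t n = s (r n)" for n
  have t: "strict_mono t" and lim: "(\<lambda>n. z (t n)) \<longlonglongrightarrow> w"
    using s(1) r lim by (auto simp: t_def o_def strict_mono_def)
  have near: "approx (t n) (z (t n)) (P n\<^sub>0) (Q n\<^sub>0)" for n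
    using approx [of "t n"] s(2) [of "r n"] by (simp add: t_def)
  have zero: "infdist v (A i) = 0"
    if "u \<longlonglongrightarrow> v" "\<And>n. infdist (u n) (A i) < inverse (real (Suc (t n)))" for u v i
  proof -
    have lim0: "(\<lambda>n. inverse (real (Suc (t n)))) \<longlonglongrightarrow> 0"
      using LIMSEQ_subseq_LIMSEQ [OF LIMSEQ_inverse_real_of_nat t] by (simp add: o_def)
    have "infdist v (A i) \<le> 0"
      by (rule LIMSEQ_le [OF tendsto_infdist [OF that(1)] lim0]) (use less_imp_le [OF that(2)] in blast)
    then show ?thesis
      using infdist_nonneg [of v "A i"] by linarith
  qed
  have lim_neg: "(\<lambda>n. - z (t n)) \<longlonglongrightarrow> - w"
    using continuous_on_tendsto_compose [OF continuous_on_uminus_fun [of UNIV] lim] by simp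
  \<comment> \<open>Distance 0 from a closed set gives membership only if the set is nonempty, since
    \<open>infdist\<close> to the empty set is 0; this is why \<open>approx\<close> records
    \<open>A i \<noteq> {}\<close>.\<close>
  have "w \<in> A i" if "i \<in> P n\<^sub>0" for i
  proof -
    have "i \<in> {1..m}" "A i \<noteq> {}"
      using near [of 0] that by (auto simp: approx_def)
    moreover have "infdist w (A i) = 0"
      using near that by (intro zero [OF lim]) (auto simp: approx_def)
    ultimately show ?thesis
      using in_closed_iff_infdist_zero closed by blast
  qed
  moreover have "w \<in> uminus ` A i" if "i \<in> Q n\<^sub>0" for i
  proof -
    have "i \<in> {1..m}" "A i \<noteq> {}"
      using near [of 0] that by (auto simp: approx_def)
    moreover have "infdist (- w) (A i) = 0"
      using near that by (intro zero [OF lim_neg]) (auto simp: approx_def)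
    ultimately have "- w \<in> A i"
      using in_closed_iff_infdist_zero closed by blast
    then show ?thesis
      by (metis image_eqI minus_minus)
  qed
  ultimately have "w \<in> (\<Inter>i\<in>P n\<^sub>0. A i) \<inter> (\<Inter>i\<in>Q n\<^sub>0. uminus ` A i)"
    by blast
  then show ?thesis
    using approx [of n\<^sub>0] unfolding approx_def by blast
qed

end
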